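(* Every separable abelian topological group is isomorphic, as a topological group, to a topological subgroup of a monothetic topological group.
   Context: A topological group is monothetic (singly generated) if it has a single topological generator, that is, it contains an element generating a cyclic subgroup that is dense in the whole group. No local compactness is assumed. A topological subgroup is a subgroup equipped with the subspace topology. *)

theory Defs
  imports "HOL-Algebra.Generated_Groups" "HOL-Analysis.Abstract_Topological_Spaces"
begin

text \<open>No separation axiom is built in; nothing below requires \<open>T\<close> to be Hausdorff.\<close>

definition topological_group :: "('a, 'm) monoid_scheme \<Rightarrow> 'a topology \<Rightarrow> bool" where
  "topological_group G T \<longleftrightarrow>
     group G \<and> topspace T = carrier G \<and>
     continuous_map (prod_topology T T) T (\<lambda>(x, y). x \<otimes>\<^bsub>G\<^esub> y) \<and>
     continuous_map T T (\<lambda>x. inv\<^bsub>G\<^esub> x)"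

definition monothetic_group :: "('a, 'm) monoid_scheme \<Rightarrow> 'a topology \<Rightarrow> bool" where
  "monothetic_group G T \<longleftrightarrow>
     topological_group G T \<and>
     (\<exists>z \<in> carrier G. T closure_of (generate G {z}) = topspace T)"

definition topological_group_isomorphic ::
    "('a, 'm) monoid_scheme \<Rightarrow> 'a topology \<Rightarrow> ('b, 'n) monoid_scheme \<Rightarrow> 'b topology \<Rightarrow> bool" where
  "topological_group_isomorphic G T H S \<longleftrightarrow> (\<exists>f \<in> iso G H. homeomorphic_map T S f)"

text \<open>
  HOL cannot quantify existentially over types, so a statement of the form "there is a monothetic
  group \<open>M\<close> containing a copy of \<open>G\<close>" has to name the type carrying \<open>M\<close>. For \<open>G\<close> on the type
  \<open>'a\<close> the type \<open>'a \<times> int\<close> loses nothing: if a copy \<open>G'\<close> of \<open>G\<close> is a topological subgroup of any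
  monothetic group with topological generator \<open>z\<close>, then the subgroup generated by \<open>G'\<close> and \<open>z\<close>,
  with the subspace topology, is again monothetic, contains \<open>G'\<close>, and has at most
  \<open>|G| \<cdot> \<aleph>\<^sub>0\<close> elements, hence can be transported to a subset of \<open>'a \<times> int\<close>. The group structure
  and the topology on that subset remain arbitrary.
\<close>

end

theory Submission
  imports Defs "HOL-Algebra.Elementary_Groups" "HOL-Algebra.FiniteProduct"
begin

text \<open>
  Choose a sequence \<open>g\<close> in \<open>G\<close> with dense range in which every value is repeated infinitely often,
  and topologise \<open>G \<times> \<int>\<close> so that \<open>(g n, - n!)\<close> tends to the identity: basic neighbourhoods
  of the identity consist of the products of \<open>(u, 0)\<close>, with \<open>u\<close> in a neighbourhood of \<open>\<one>\<close> in \<open>G\<close>,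
  and of integer powers \<open>c n\<close> of finitely many \<open>(g n, - n!)\<close> with \<open>\<Sum>n. \<bar>c n\<bar> / (n + 1) < r\<close>.
  Then the powers \<open>(\<one>, n!)\<close> of \<open>(\<one>, 1)\<close> approximate the points \<open>(g n, 0)\<close>, so \<open>(\<one>, 1)\<close>
  is a topological generator. Because
  of the growth of the factorials, a nontrivial relation \<open>\<Sum>n. c n * n! = 0\<close> forces
  \<open>\<Sum>n. \<bar>c n\<bar> / (n + 1) \<ge> 1\<close>; hence for \<open>r \<le> 1\<close> the neighbourhoods trace the original ones on
  \<open>G \<times> {0}\<close>.
\<close>

section \<open>Group topologies from neighbourhood bases of the identity\<close>

text \<open>The classical axioms of a neighbourhood base at the identity of a group topology;
  conjugation invariance is automatic in a commutative group. Members of \<open>\<B>\<close> may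
  fail to be open.\<close>

locale group_nhds_base = comm_group G for G (structure) +
  fixes \<B> :: "'a set set"
  assumes base_nonempty: "\<B> \<noteq> {}"
    and base_subset: "B \<in> \<B> \<Longrightarrow> B \<subseteq> carrier G"
    and base_one: "B \<in> \<B> \<Longrightarrow> \<one> \<in> B"
    and base_Int: "\<lbrakk>B \<in> \<B>; C \<in> \<B>\<rbrakk> \<Longrightarrow> \<exists>D\<in>\<B>. D \<subseteq> B \<inter> C"
    and base_mult: "B \<in> \<B> \<Longrightarrow> \<exists>C\<in>\<B>. \<forall>x\<in>C. \<forall>y\<in>C. x \<otimes> y \<in> B"
    and base_inv: "B \<in> \<B> \<Longrightarrow> \<exists>C\<in>\<B>. \<forall>x\<in>C. inv x \<in> B"
begin

definition base_topology :: "'a topology" where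
  "base_topology =
     topology (\<lambda>A. A \<subseteq> carrier G \<and> (\<forall>x\<in>A. \<exists>B\<in>\<B>. \<forall>b\<in>B. x \<otimes> b \<in> A))"

lemma openin_base_topology:
  "openin base_topology A \<longleftrightarrow> A \<subseteq> carrier G \<and> (\<forall>x\<in>A. \<exists>B\<in>\<B>. \<forall>b\<in>B. x \<otimes> b \<in> A)"
proof -
  have "istopology (\<lambda>A. A \<subseteq> carrier G \<and> (\<forall>x\<in>A. \<exists>B\<in>\<B>. \<forall>b\<in>B. x \<otimes> b \<in> A))"
    unfolding istopology_def
  proof (intro conjI allI impI)
    fix S T
    assume S: "S \<subseteq> carrier G \<and> (\<forall>x\<in>S. \<exists>B\<in>\<B>. \<forall>b\<in>B. x \<otimes> b \<in> S)"
      and T: "T \<subseteq> carrier G \<and> (\<forall>x\<in>T. \<exists>B\<in>\<B>. \<forall>b\<in>B. x \<otimes> b \<in> T)"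
    show "S \<inter> T \<subseteq> carrier G" using S by blast
    show "\<forall>x\<in>S \<inter> T. \<exists>B\<in>\<B>. \<forall>b\<in>B. x \<otimes> b \<in> S \<inter> T"
    proof
      fix x assume "x \<in> S \<inter> T"
      then obtain B C where B: "B \<in> \<B>" "\<forall>b\<in>B. x \<otimes> b \<in> S" and C: "C \<in> \<B>" "\<forall>b\<in>C. x \<otimes> b \<in> T"
        using S T by blast
      obtain D where "D \<in> \<B>" "D \<subseteq> B \<inter> C" using base_Int B(1) C(1) by blast
      with B C show "\<exists>B\<in>\<B>. \<forall>b\<in>B. x \<otimes> b \<in> S \<inter> T" by blast
    qed
  next
    fix \<K> assume "\<forall>K\<in>\<K>. K \<subseteq> carrier G \<and> (\<forall>x\<in>K. \<exists>B\<in>\<B>. \<forall>b\<in>B. x \<otimes> b \<in> K)"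
    then show "\<Union>\<K> \<subseteq> carrier G" "\<forall>x\<in>\<Union>\<K>. \<exists>B\<in>\<B>. \<forall>b\<in>B. x \<otimes> b \<in> \<Union>\<K>"
      by (blast, meson UnionE UnionI)
  qed
  then show ?thesis
    unfolding base_topology_def by (simp add: topology_inverse')
qed

lemma topspace_base_topology: "topspace base_topology = carrier G"
proof
  show "topspace base_topology \<subseteq> carrier G"
    using openin_base_topology openin_topspace by blast
  have "openin base_topology (carrier G)"
    unfolding openin_base_topology using base_nonempty base_subset m_closed by blast
  then show "carrier G \<subseteq> topspace base_topology" by (rule openin_subset)
qed

text \<open>As \<open>B\<close> need not be open, its translate by \<open>x\<close> need not be
  either; this places an open set around \<open>x\<close> inside the translate.\<close>

lemma base_topology_nhd:
  assumes "x \<in> carrier G" "B \<in> \<B>"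
  obtains A where "openin base_topology A" "x \<in> A" "\<And>y. y \<in> A \<Longrightarrow> \<exists>b\<in>B. y = x \<otimes> b"
proof
  \<comment> \<open>The interior of the translate: points around which a translate of some
    \<open>C\<close> stays inside. Openness comes from \<open>base_mult\<close>: if products of two
    elements of \<open>D\<close> lie in \<open>C\<close>, then \<open>D\<close> is a witness for
    \<open>y \<otimes> d\<close>.\<close>
  define A where "A = {y \<in> carrier G. \<exists>C\<in>\<B>. \<forall>c\<in>C. \<exists>b\<in>B. y \<otimes> c = x \<otimes> b}"
  show "x \<in> A" using assms by (auto simp: A_def)
  show "\<exists>b\<in>B. y = x \<otimes> b" if "y \<in> A" for y
  proof -
    obtain C where y: "y \<in> carrier G" and C: "C \<in> \<B>" "\<forall>c\<in>C. \<exists>b\<in>B. y \<otimes> c = x \<otimes> b"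
      using \<open>y \<in> A\<close> by (auto simp: A_def)
    then have "\<exists>b\<in>B. y \<otimes> \<one> = x \<otimes> b" using base_one by blast
    then show ?thesis using y by simp
  qed
  show "openin base_topology A"
    unfolding openin_base_topology
  proof (intro conjI ballI)
    show "A \<subseteq> carrier G" by (auto simp: A_def)
    fix y assume "y \<in> A"
    then obtain C where y: "y \<in> carrier G" and C: "C \<in> \<B>" "\<forall>c\<in>C. \<exists>b\<in>B. y \<otimes> c = x \<otimes> b"
      by (auto simp: A_def)
    obtain D where D: "D \<in> \<B>" "\<forall>x\<in>D. \<forall>y\<in>D. x \<otimes> y \<in> C" using base_mult C(1) by blast
    have "y \<otimes> d \<in> A" if "d \<in> D" for d
    proof -
      have D_closed: "e \<in> carrier G" if "e \<in> D" for e using base_subset[OF D(1)] that by blast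
      have "\<exists>b\<in>B. (y \<otimes> d) \<otimes> e = x \<otimes> b" if "e \<in> D" for e
      proof -
        have "\<exists>b\<in>B. y \<otimes> (d \<otimes> e) = x \<otimes> b" using C(2) D(2) \<open>d \<in> D\<close> that by blast
        then show ?thesis using y D_closed \<open>d \<in> D\<close> that by (simp add: m_assoc)
      qed
      moreover have "y \<otimes> d \<in> carrier G" using y D_closed \<open>d \<in> D\<close> by blast
      ultimately show ?thesis unfolding A_def using D(1) by blast
    qed
    then show "\<exists>B\<in>\<B>. \<forall>b\<in>B. y \<otimes> b \<in> A" using D(1) by blast
  qed
qed

lemma topological_group_base_topology: "topological_group G base_topology"
  unfolding topological_group_def
proof (intro conjI)
  show "group G" by (rule is_group)
  show "topspace base_topology = carrier G" by (rule topspace_base_topology)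
  show "continuous_map (prod_topology base_topology base_topology) base_topology (\<lambda>(x, y). x \<otimes> y)"
    unfolding continuous_map_def
  proof (intro conjI allI impI)
    show "(\<lambda>(x, y). x \<otimes> y) \<in> topspace (prod_topology base_topology base_topology) \<rightarrow> topspace base_topology"
      by (auto simp: topspace_base_topology)
    fix A assume A: "openin base_topology A"
    let ?P = "{p \<in> topspace (prod_topology base_topology base_topology). (case p of (x, y) \<Rightarrow> x \<otimes> y) \<in> A}"
    show "openin (prod_topology base_topology base_topology) ?P"
      unfolding openin_prod_topology_alt
    proof (intro allI impI)
      fix x y assume "(x, y) \<in> ?P"
      then have x: "x \<in> carrier G" and y: "y \<in> carrier G" and xy: "x \<otimes> y \<in> A"
        by (auto simp: topspace_base_topology)
      obtain B where B: "B \<in> \<B>" "\<forall>b\<in>B. x \<otimes> y \<otimes> b \<in> A" using A xy by (auto simp: openin_base_topology)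
      obtain C where C: "C \<in> \<B>" "\<forall>x\<in>C. \<forall>y\<in>C. x \<otimes> y \<in> B" using base_mult B(1) by blast
      obtain U where U: "openin base_topology U" "x \<in> U" "\<And>u. u \<in> U \<Longrightarrow> \<exists>c\<in>C. u = x \<otimes> c"
        using base_topology_nhd[OF x C(1)] by metis
      obtain V where V: "openin base_topology V" "y \<in> V" "\<And>v. v \<in> V \<Longrightarrow> \<exists>c\<in>C. v = y \<otimes> c"
        using base_topology_nhd[OF y C(1)] by metis
      have "u \<otimes> v \<in> A" if "u \<in> U" "v \<in> V" for u v
      proof -
        obtain c d where c: "c \<in> C" "u = x \<otimes> c" and d: "d \<in> C" "v = y \<otimes> d"
          using U(3) V(3) \<open>u \<in> U\<close> \<open>v \<in> V\<close> by blast
        moreover have "c \<in> carrier G" "d \<in> carrier G" using base_subset C(1) c d by blast+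
        \<comment> \<open>Commutativity moves \<open>c\<close> past \<open>y\<close>, so only
          \<open>c \<otimes> d\<close> has to be controlled.\<close>
        ultimately have "u \<otimes> v = x \<otimes> y \<otimes> (c \<otimes> d)" using x y by (simp add: m_ac)
        then show ?thesis using B C c d by auto
      qed
      moreover have "U \<subseteq> topspace base_topology" "V \<subseteq> topspace base_topology"
        using U(1) V(1) openin_subset by blast+
      ultimately have "U \<times> V \<subseteq> ?P" by auto
      then show "\<exists>U V. openin base_topology U \<and> openin base_topology V \<and> x \<in> U \<and> y \<in> V \<and> U \<times> V \<subseteq> ?P"
        using U V by blast
    qed
  qed
  show "continuous_map base_topology base_topology (\<lambda>x. inv x)"
    unfolding continuous_map_def
  proof (intro conjI allI impI)
    show "(\<lambda>x. inv x) \<in> topspace base_topology \<rightarrow> topspace base_topology"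
      by (auto simp: topspace_base_topology)
    fix A assume A: "openin base_topology A"
    have "\<exists>B\<in>\<B>. \<forall>b\<in>B. x \<otimes> b \<in> {x \<in> carrier G. inv x \<in> A}" if x: "x \<in> carrier G" "inv x \<in> A" for x
    proof -
      obtain B where B: "B \<in> \<B>" "\<forall>b\<in>B. inv x \<otimes> b \<in> A" using A x(2) by (auto simp: openin_base_topology)
      obtain C where C: "C \<in> \<B>" "\<forall>c\<in>C. inv c \<in> B" using base_inv B(1) by blast
      have "x \<otimes> c \<in> carrier G \<and> inv (x \<otimes> c) \<in> A" if "c \<in> C" for c
      proof -
        have "c \<in> carrier G" using base_subset[OF C(1)] that by blast
        then show ?thesis using B(2) C(2) that x(1) by (simp add: inv_mult)
      qed
      then show ?thesis using C(1) by blast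
    qed
    then show "openin base_topology {x \<in> topspace base_topology. inv x \<in> A}"
      unfolding topspace_base_topology by (auto simp: openin_base_topology)
  qed
qed

end

section \<open>Topological groups\<close>

lemma topological_group_continuous_translation:
  assumes "topological_group G T" "a \<in> carrier G"
  shows "continuous_map T T (\<lambda>x. a \<otimes>\<^bsub>G\<^esub> x)"
proof -
  have "continuous_map T (prod_topology T T) (\<lambda>x. (a, x))"
    using assms by (intro continuous_map_pairedI) (auto simp: topological_group_def)
  moreover have "continuous_map (prod_topology T T) T (\<lambda>(x, y). x \<otimes>\<^bsub>G\<^esub> y)"
    using assms by (simp add: topological_group_def)
  ultimately show ?thesis
    using continuous_map_compose[of T "prod_topology T T" "\<lambda>x. (a, x)" T "\<lambda>(x, y). x \<otimes>\<^bsub>G\<^esub> y"]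
    by (simp add: o_def)
qed

lemma topological_group_openin_translation:
  assumes "topological_group G T" "a \<in> carrier G" "openin T U"
  shows "openin T {x \<in> carrier G. a \<otimes>\<^bsub>G\<^esub> x \<in> U}"
  using openin_continuous_map_preimage[OF topological_group_continuous_translation[OF assms(1,2)] assms(3)]
    assms(1) by (simp add: topological_group_def)

lemma topological_group_openin_inverse:
  assumes "topological_group G T" "openin T U"
  shows "openin T {x \<in> carrier G. inv\<^bsub>G\<^esub> x \<in> U}"
  using openin_continuous_map_preimage[of T T "\<lambda>x. inv\<^bsub>G\<^esub> x" U] assms
  by (simp add: topological_group_def)

lemma topological_group_square_nhd:
  assumes "topological_group G T" "openin T U" "\<one>\<^bsub>G\<^esub> \<in> U"
  obtains V where "openin T V" "\<one>\<^bsub>G\<^esub> \<in> V" "\<And>x y. \<lbrakk>x \<in> V; y \<in> V\<rbrakk> \<Longrightarrow> x \<otimes>\<^bsub>G\<^esub> y \<in> U"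
proof -
  interpret group G using assms(1) by (simp add: topological_group_def)
  let ?P = "{p \<in> topspace (prod_topology T T). (case p of (x, y) \<Rightarrow> x \<otimes>\<^bsub>G\<^esub> y) \<in> U}"
  have "openin (prod_topology T T) ?P"
    using assms openin_continuous_map_preimage unfolding topological_group_def by blast
  moreover have "(\<one>\<^bsub>G\<^esub>, \<one>\<^bsub>G\<^esub>) \<in> ?P"
    using assms by (auto simp: topological_group_def)
  ultimately obtain V W where VW: "openin T V" "openin T W" "\<one>\<^bsub>G\<^esub> \<in> V" "\<one>\<^bsub>G\<^esub> \<in> W" "V \<times> W \<subseteq> ?P"
    unfolding openin_prod_topology_alt by meson
  show thesis
  proof
    show "openin T (V \<inter> W)" "\<one>\<^bsub>G\<^esub> \<in> V \<inter> W" using VW by auto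
    show "x \<otimes>\<^bsub>G\<^esub> y \<in> U" if "x \<in> V \<inter> W" "y \<in> V \<inter> W" for x y using VW(5) that by auto
  qed
qed

text \<open>Plain density would allow an isolated point to be visited only once. Recurrence at late
  indices later gives \<open>g n\<close> near a prescribed point and \<open>1 / (n + 1)\<close>
  small for the same \<open>n\<close>.\<close>

lemma dense_sequence_frequently:
  assumes "separable_space T" "topspace T \<noteq> {}"
  obtains g where "range g \<subseteq> topspace T"
    and "\<forall>U. openin T U \<and> U \<noteq> {} \<longrightarrow> (\<forall>m::nat. \<exists>n\<ge>m. g n \<in> U)"
proof -
  obtain D where D: "countable D" "D \<subseteq> topspace T" "T closure_of D = topspace T"
    using assms(1) by (auto simp: separable_space_def)
  have "D \<noteq> {}"
    using D(3) assms(2) closure_of_empty[of T] by (intro notI) simp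
  \<comment> \<open>Only the first component of the decoded pair counts, so each value recurs; the
    code of \<open>(i, m)\<close> is an index that is at least \<open>m\<close>.\<close>
  define g where "g n = from_nat_into D (fst (prod_decode n))" for n
  show thesis
  proof
    show "range g \<subseteq> topspace T"
      unfolding g_def using from_nat_into[OF \<open>D \<noteq> {}\<close>] D by blast
    show "\<forall>U. openin T U \<and> U \<noteq> {} \<longrightarrow> (\<forall>m. \<exists>n\<ge>m. g n \<in> U)"
    proof (intro allI impI)
      fix U m assume U: "openin T U \<and> U \<noteq> {}"
      then obtain x where x: "x \<in> U" by blast
      then have "x \<in> T closure_of D" using U D(3) openin_subset by blast
      then obtain d where d: "d \<in> D" "d \<in> U" using U x unfolding in_closure_of by blast
      obtain i where i: "from_nat_into D i = d" using from_nat_into_surj[OF D(1) d(1)] by blast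
      have "g (prod_encode (i, m)) \<in> U" by (simp add: g_def i d)
      then show "\<exists>n\<ge>m. g n \<in> U" using le_prod_encode_2 by blast
    qed
  qed
qed

section \<open>The topology on the product with the integers\<close>

text \<open>A nonzero top coefficient gives a term of size at least \<open>fact N\<close>, but the
  lower terms sum to less than that. The weights \<open>1 / (n + 1)\<close> tend to 0 and still
  suffice, since \<open>(n + 1) * fact n = fact (n + 1) \<le> fact N\<close> for
  \<open>n < N\<close>.\<close>

lemma small_fact_combination_trivial:
  fixes c :: "nat \<Rightarrow> int"
  assumes "(\<Sum>n<N. c n * fact n) = 0" "(\<Sum>n<N. real_of_int \<bar>c n\<bar> / (real n + 1)) < 1" "n < N"
  shows "c n = 0"
  using assms
proof (induction N)
  case 0
  then show ?case by simp
next
  case (Suc N)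
  have "c N = 0"
  proof (rule ccontr)
    assume "c N \<noteq> 0"
    then have "(fact N :: real) \<le> \<bar>of_int (c N)\<bar> * fact N"
      by simp
    also have "\<dots> = \<bar>of_int (\<Sum>n<N. c n * fact n)\<bar>"
    proof -
      have "c N * fact N = - (\<Sum>n<N. c n * fact n)" using Suc.prems(1) by simp
      then have "\<bar>c N * fact N\<bar> = \<bar>\<Sum>n<N. c n * fact n\<bar>" by simp
      then have "real_of_int \<bar>c N * fact N\<bar> = of_int \<bar>\<Sum>n<N. c n * fact n\<bar>" by (rule arg_cong)
      then show ?thesis by (simp add: abs_mult)
    qed
    also have "\<dots> \<le> (\<Sum>n<N. of_int \<bar>c n\<bar> * fact n)"
      using sum_abs[of "\<lambda>n. real_of_int (c n * fact n)" "{..<N}"] by (simp add: abs_mult)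
    also have "\<dots> \<le> (\<Sum>n<N. of_int \<bar>c n\<bar> / (real n + 1) * fact N)"
    proof (rule sum_mono)
      fix n assume "n \<in> {..<N}"
      then have "(fact (Suc n) :: real) \<le> fact N" by (intro fact_mono) auto
      then have "(fact n :: real) \<le> fact N / (real n + 1)" by (simp add: field_simps)
      then show "of_int \<bar>c n\<bar> * fact n \<le> of_int \<bar>c n\<bar> / (real n + 1) * (fact N :: real)"
        using mult_left_mono[of "fact n :: real" "fact N / (real n + 1)" "of_int \<bar>c n\<bar>"] by simp
    qed
    also have "\<dots> = (\<Sum>n<N. of_int \<bar>c n\<bar> / (real n + 1)) * fact N"
      by (simp add: sum_distrib_right)
    also have "\<dots> < 1 * fact N"
    proof (rule mult_strict_right_mono)
      have "0 \<le> real_of_int \<bar>c N\<bar> / (real N + 1)" by simp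
      then show "(\<Sum>n<N. of_int \<bar>c n\<bar> / (real n + 1)) < (1 :: real)"
        using Suc.prems(2) unfolding sum.lessThan_Suc by linarith
    qed simp
    finally show False by simp
  qed
  \<comment> \<open>With \<open>c N = 0\<close>, both hypotheses pass to the first \<open>N\<close>
    coefficients.\<close>
  then show ?case using Suc by (cases "n = N") auto
qed

section \<open>Words in the elements \<open>(g n, - fact n)\<close> and their weighted
  length\<close>

locale sequence_in_comm_group = comm_group G for G (structure) +
  fixes g :: "nat \<Rightarrow> 'a"
  assumes g_closed [simp]: "g n \<in> carrier G"
begin

abbreviation power_prod :: "nat \<Rightarrow> (nat \<Rightarrow> int) \<Rightarrow> 'a" where
  "power_prod N c \<equiv> (\<Otimes>n\<in>{..<N}. g n [^] c n)"

lemma power_prod_add: "power_prod N (\<lambda>n. c n + d n) = power_prod N c \<otimes> power_prod N d"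
  by (simp add: int_pow_mult Pi_def)

lemma power_prod_closed [simp]: "power_prod N c \<in> carrier G"
  by (simp add: Pi_def)

lemma power_prod_zero [simp]: "(\<And>n. n < N \<Longrightarrow> c n = 0) \<Longrightarrow> power_prod N c = \<one>"
  by (rule finprod_one_eqI) simp

lemma power_prod_minus: "power_prod N (\<lambda>n. - c n) = inv (power_prod N c)"
  by (rule inv_equality[symmetric]) (simp_all flip: power_prod_add)

text \<open>The open ball of radius \<open>r\<close> around the identity in the subgroup generated
  by the elements \<open>(g n, - fact n)\<close>, for the length that charges
  \<open>1 / (n + 1)\<close> per use of the \<open>n\<close>-th one. Since \<open>c\<close> vanishes
  from \<open>N\<close> on, \<open>N\<close> can be enlarged freely.\<close>

definition small_words :: "real \<Rightarrow> ('a \<times> int) set" where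
  "small_words r = {(power_prod N c, - (\<Sum>n<N. c n * fact n)) | N c.
     (\<forall>n\<ge>N. c n = 0) \<and> (\<Sum>n<N. real_of_int \<bar>c n\<bar> / (real n + 1)) < r}"

lemma small_wordsI:
  assumes "\<And>n. n \<ge> N \<Longrightarrow> c n = 0" "(\<Sum>n<N. real_of_int \<bar>c n\<bar> / (real n + 1)) < r"
  shows "(power_prod N c, - (\<Sum>n<N. c n * fact n)) \<in> small_words r"
  using assms unfolding small_words_def by blast

lemma small_wordsE:
  assumes "w \<in> small_words r"
  obtains N c where "w = (power_prod N c, - (\<Sum>n<N. c n * fact n))"
    "\<And>n. n \<ge> N \<Longrightarrow> c n = 0" "(\<Sum>n<N. real_of_int \<bar>c n\<bar> / (real n + 1)) < r"
  using assms unfolding small_words_def by blast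

text \<open>Padding with zero coefficients changes nothing, so two words can be written over a
  common bound before they are combined.\<close>

lemma small_wordsE_ge:
  assumes "w \<in> small_words r"
  obtains N c where
    "\<And>M. M \<ge> N \<Longrightarrow> (\<forall>n\<ge>M. c n = 0) \<and> (\<Sum>n<M. real_of_int \<bar>c n\<bar> / (real n + 1)) < r \<and>
       w = (power_prod M c, - (\<Sum>n<M. c n * fact n))"
proof -
  from assms obtain N c where w: "w = (power_prod N c, - (\<Sum>n<N. c n * fact n))"
    and c: "\<And>n. n \<ge> N \<Longrightarrow> c n = 0"
    and less: "(\<Sum>n<N. real_of_int \<bar>c n\<bar> / (real n + 1)) < r"
    by (rule small_wordsE) blast
  show thesis
  proof
    fix M assume "M \<ge> N"
    then have "{..<N} \<subseteq> {..<M}" by auto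
    then have "(\<Sum>n<M. real_of_int \<bar>c n\<bar> / (real n + 1)) = (\<Sum>n<N. real_of_int \<bar>c n\<bar> / (real n + 1))"
      "(\<Sum>n<M. c n * fact n) = (\<Sum>n<N. c n * fact n)"
      by (intro sum.mono_neutral_right; use c in auto)+
    moreover have "power_prod N c = power_prod M c"
      using \<open>{..<N} \<subseteq> {..<M}\<close> c by (intro finprod_mono_neutral_cong_left) auto
    ultimately show "(\<forall>n\<ge>M. c n = 0) \<and> (\<Sum>n<M. real_of_int \<bar>c n\<bar> / (real n + 1)) < r \<and>
       w = (power_prod M c, - (\<Sum>n<M. c n * fact n))"
      using w c less \<open>M \<ge> N\<close> by simp
  qed
qed

lemma small_words_one: "r > 0 \<Longrightarrow> (\<one>, 0) \<in> small_words r"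
  using small_wordsI[of 0 "\<lambda>_. 0" r] by simp

lemma small_words_closed: "(a, m) \<in> small_words r \<Longrightarrow> a \<in> carrier G"
  by (auto elim: small_wordsE)

lemma small_words_mono: "r \<le> s \<Longrightarrow> w \<in> small_words r \<Longrightarrow> w \<in> small_words s"
  unfolding small_words_def by force

text \<open>Coefficients add, and the weighted length obeys the triangle inequality.\<close>

lemma small_words_mult:
  assumes "(a, m) \<in> small_words r" "(b, k) \<in> small_words s"
  shows "(a \<otimes> b, m + k) \<in> small_words (r + s)"
proof -
  from assms(1) obtain N c where c: "\<And>M. M \<ge> N \<Longrightarrow> (\<forall>n\<ge>M. c n = 0) \<and>
       (\<Sum>n<M. real_of_int \<bar>c n\<bar> / (real n + 1)) < r \<and> (a, m) = (power_prod M c, - (\<Sum>n<M. c n * fact n))"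
    by (erule small_wordsE_ge)
  from assms(2) obtain N' d where d: "\<And>M. M \<ge> N' \<Longrightarrow> (\<forall>n\<ge>M. d n = 0) \<and>
       (\<Sum>n<M. real_of_int \<bar>d n\<bar> / (real n + 1)) < s \<and> (b, k) = (power_prod M d, - (\<Sum>n<M. d n * fact n))"
    by (erule small_wordsE_ge)
  define M where "M = max N N'"
  note c = c[of M] and d = d[of M]
  have "(\<Sum>n<M. real_of_int \<bar>c n + d n\<bar> / (real n + 1))
      \<le> (\<Sum>n<M. real_of_int \<bar>c n\<bar> / (real n + 1) + real_of_int \<bar>d n\<bar> / (real n + 1))"
    by (intro sum_mono) (simp add: divide_right_mono flip: add_divide_distrib)
  also have "\<dots> < r + s" using c d by (simp add: sum.distrib M_def)
  finally have "(power_prod M (\<lambda>n. c n + d n), - (\<Sum>n<M. (c n + d n) * fact n)) \<in> small_words (r + s)"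
    using c d by (intro small_wordsI) (auto simp: M_def)
  then show ?thesis
    unfolding power_prod_add using c d by (simp add: M_def sum.distrib distrib_right)
qed

lemma small_words_inv:
  assumes "(a, m) \<in> small_words r"
  shows "(inv a, - m) \<in> small_words r"
  using assms
proof (rule small_wordsE)
  fix N c
  assume "(a, m) = (power_prod N c, - (\<Sum>n<N. c n * fact n))"
    and "\<And>n. n \<ge> N \<Longrightarrow> c n = 0" "(\<Sum>n<N. real_of_int \<bar>c n\<bar> / (real n + 1)) < r"
  then show ?thesis
    using small_wordsI[of N "\<lambda>n. - c n" r] by (simp add: power_prod_minus sum_negf)
qed

text \<open>The coefficients are the unit vector at \<open>n\<close>. As the weights tend to 0,
  every positive radius captures all late elements \<open>(g n, - fact n)\<close>; this is their
  convergence to the identity.\<close>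

lemma small_words_generator:
  assumes "1 / (real n + 1) < r"
  shows "(g n, - fact n) \<in> small_words r"
proof -
  define c :: "nat \<Rightarrow> int" where "c i = (if i = n then 1 else 0)" for i
  have "power_prod (Suc n) c = (\<Otimes>i\<in>{..<Suc n}. if i = n then g i else \<one>)"
    by (rule finprod_cong) (auto simp: c_def simp_implies_def)
  also have "\<dots> = g n" by (rule finprod_singleton_swap) auto
  finally have "power_prod (Suc n) c = g n" .
  moreover have "(\<Sum>i<Suc n. c i * fact i) = fact n" "(\<Sum>i<Suc n. real_of_int \<bar>c i\<bar> / (real i + 1)) = 1 / (real n + 1)"
    by (simp_all add: c_def)
  ultimately show ?thesis using small_wordsI[of "Suc n" c r] assms by (simp add: c_def)
qed

text \<open>A vanishing integer component is a relation among factorials of total weight below 1, so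
  all coefficients are zero. Short words thus meet \<open>G \<times> {0}\<close> only in the
  identity.\<close>

lemma small_words_kernel:
  assumes "(a, 0) \<in> small_words r" "r \<le> 1"
  shows "a = \<one>"
  using assms(1)
proof (rule small_wordsE)
  fix N c
  assume eq: "(a, 0) = (power_prod N c, - (\<Sum>n<N. c n * fact n))"
    and less: "(\<Sum>n<N. real_of_int \<bar>c n\<bar> / (real n + 1)) < r"
  have "c n = 0" if "n < N" for n
    using small_fact_combination_trivial[of c N n] that eq less assms(2) by simp
  then show ?thesis using eq by simp
qed

section \<open>Neighbourhoods combining an open set of \<open>G\<close> with short words\<close>

definition word_nhd :: "'a set \<Rightarrow> real \<Rightarrow> ('a \<times> int) set" where
  "word_nhd U r = {(u \<otimes> a, m) | u a m. u \<in> U \<and> (a, m) \<in> small_words r}"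

lemma word_nhdI: "\<lbrakk>u \<in> U; (a, m) \<in> small_words r\<rbrakk> \<Longrightarrow> (u \<otimes> a, m) \<in> word_nhd U r"
  by (auto simp: word_nhd_def)

lemma word_nhd_mono:
  assumes "U \<subseteq> V" "r \<le> s"
  shows "word_nhd U r \<subseteq> word_nhd V s"
  using assms small_words_mono by (fastforce simp: word_nhd_def)

text \<open>The integer component comes from the word alone. If it is 0, the short word is trivial
  and only the factor from \<open>U\<close> is left.\<close>

lemma word_nhd_kernel:
  assumes "(x, 0) \<in> word_nhd U r" "r \<le> 1" "U \<subseteq> carrier G"
  shows "x \<in> U"
  using assms small_words_kernel unfolding word_nhd_def by fastforce

definition word_nhds :: "'a topology \<Rightarrow> ('a \<times> int) set set" where
  "word_nhds T = {word_nhd U r | U r. openin T U \<and> \<one> \<in> U \<and> r > 0}"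

lemma word_nhdsI: "\<lbrakk>openin T U; \<one> \<in> U; r > 0\<rbrakk> \<Longrightarrow> word_nhd U r \<in> word_nhds T"
  by (auto simp: word_nhds_def)

lemma comm_group_times_integer: "comm_group (G \<times>\<times> integer_group)"
proof -
  interpret P: group "G \<times>\<times> integer_group" by (intro DirProd_group is_group group_integer_group)
  show ?thesis by (rule P.group_comm_groupI) (auto simp: m_comm)
qed

text \<open>The open sets inherit the axioms from \<open>T\<close>, and the words from the length:
  the radius is halved for products, kept for inverses, and replaced by a minimum for
  intersections.\<close>

lemma group_nhds_base_word_nhds:
  assumes T: "topological_group G T"
  shows "group_nhds_base (G \<times>\<times> integer_group) (word_nhds T)"
proof -
  interpret P: comm_group "G \<times>\<times> integer_group" by (rule comm_group_times_integer)
  have top: "topspace T = carrier G" using T by (simp add: topological_group_def)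
  have sub: "U \<subseteq> carrier G" if "openin T U" for U
    using that openin_subset top by blast
  show ?thesis
  proof
    show "word_nhds T \<noteq> {}"
      using word_nhdsI[of T "carrier G" 1] openin_topspace[of T] top by auto
  next
    fix B assume "B \<in> word_nhds T"
    then obtain U r where U: "openin T U" "\<one> \<in> U" "r > 0" and B: "B = word_nhd U r"
      by (auto simp: word_nhds_def)
    show "B \<subseteq> carrier (G \<times>\<times> integer_group)"
      using sub[OF U(1)] small_words_closed by (fastforce simp: B word_nhd_def)
    show "\<one>\<^bsub>G \<times>\<times> integer_group\<^esub> \<in> B"
      using word_nhdI[OF U(2) small_words_one[OF U(3)]] by (simp add: B)
    show "\<exists>C\<in>word_nhds T. \<forall>x\<in>C. \<forall>y\<in>C. x \<otimes>\<^bsub>G \<times>\<times> integer_group\<^esub> y \<in> B"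
    proof -
      obtain V where V: "openin T V" "\<one> \<in> V" "\<And>x y. \<lbrakk>x \<in> V; y \<in> V\<rbrakk> \<Longrightarrow> x \<otimes> y \<in> U"
        using topological_group_square_nhd[OF T U(1,2)] by metis
      have "x \<otimes>\<^bsub>G \<times>\<times> integer_group\<^esub> y \<in> B" if xy: "x \<in> word_nhd V (r/2)" "y \<in> word_nhd V (r/2)" for x y
      proof -
        obtain u a m where x: "x = (u \<otimes> a, m)" "u \<in> V" "(a, m) \<in> small_words (r/2)"
          using xy(1) by (auto simp: word_nhd_def)
        obtain v b k where y: "y = (v \<otimes> b, k)" "v \<in> V" "(b, k) \<in> small_words (r/2)"
          using xy(2) by (auto simp: word_nhd_def)
        have "(a \<otimes> b, m + k) \<in> small_words r" using small_words_mult[OF x(3) y(3)] by simp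
        \<comment> \<open>By commutativity the product of \<open>u \<otimes> a\<close> and
          \<open>v \<otimes> b\<close> regroups into an element of \<open>U\<close> and a word of
          length below \<open>r\<close>.\<close>
        then have "((u \<otimes> v) \<otimes> (a \<otimes> b), m + k) \<in> B"
          unfolding B using V(3) x y by (intro word_nhdI)
        moreover have "u \<in> carrier G" "v \<in> carrier G" "a \<in> carrier G" "b \<in> carrier G"
          using sub[OF V(1)] x y small_words_closed by blast+
        ultimately show ?thesis by (simp add: x(1) y(1) m_ac)
      qed
      moreover have "word_nhd V (r/2) \<in> word_nhds T" using V(1,2) U(3) by (intro word_nhdsI) auto
      ultimately show ?thesis by blast
    qed
    show "\<exists>C\<in>word_nhds T. \<forall>x\<in>C. inv\<^bsub>G \<times>\<times> integer_group\<^esub> x \<in> B"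
    proof -
      let ?V = "{x \<in> carrier G. inv x \<in> U}"
      have "inv\<^bsub>G \<times>\<times> integer_group\<^esub> x \<in> B" if nhd: "x \<in> word_nhd ?V r" for x
      proof -
        obtain u a m where x: "x = (u \<otimes> a, m)" "u \<in> ?V" "(a, m) \<in> small_words r"
          using nhd by (auto simp: word_nhd_def)
        have "(inv u \<otimes> inv a, - m) \<in> B"
          unfolding B using x small_words_inv by (intro word_nhdI) auto
        then show ?thesis
          using x small_words_closed[OF x(3)] by (simp add: is_group inv_mult)
      qed
      moreover have "word_nhd ?V r \<in> word_nhds T"
        using U topological_group_openin_inverse[OF T U(1)] by (intro word_nhdsI) auto
      ultimately show ?thesis by blast
    qed
    fix C assume "C \<in> word_nhds T"
    then obtain V s where V: "openin T V" "\<one> \<in> V" "s > 0" and C: "C = word_nhd V s"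
      by (auto simp: word_nhds_def)
    have "word_nhd (U \<inter> V) (min r s) \<subseteq> B \<inter> C"
      unfolding B C by (intro Int_greatest word_nhd_mono) auto
    moreover have "word_nhd (U \<inter> V) (min r s) \<in> word_nhds T"
      using U V by (intro word_nhdsI) auto
    ultimately show "\<exists>D\<in>word_nhds T. D \<subseteq> B \<inter> C" by blast
  qed
qed

section \<open>The resulting topology: its topological generator and its trace on
  \<open>G \<times> {0}\<close>\<close>

abbreviation word_topology :: "'a topology \<Rightarrow> ('a \<times> int) topology" where
  "word_topology T \<equiv> group_nhds_base.base_topology (G \<times>\<times> integer_group) (word_nhds T)"

lemma openin_word_topologyE:
  assumes T: "topological_group G T" and A: "openin (word_topology T) A" "x \<in> A"
  obtains U r where "openin T U" "\<one> \<in> U" "r > 0"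
    "\<And>b. b \<in> word_nhd U r \<Longrightarrow> x \<otimes>\<^bsub>G \<times>\<times> integer_group\<^esub> b \<in> A"
proof -
  interpret P: group_nhds_base "G \<times>\<times> integer_group" "word_nhds T"
    by (rule group_nhds_base_word_nhds[OF T])
  obtain B where B: "B \<in> word_nhds T" "\<forall>b\<in>B. x \<otimes>\<^bsub>G \<times>\<times> integer_group\<^esub> b \<in> A"
    using A by (auto simp: P.openin_base_topology)
  obtain U r where "openin T U" "\<one> \<in> U" "r > 0" "B = word_nhd U r"
    using B(1) unfolding word_nhds_def by blast
  then show thesis using that[of U r] B(2) by simp
qed

text \<open>For late \<open>n\<close>, \<open>(g n, - fact n)\<close> is near the identity, so
  \<open>(\<one>, m + fact n)\<close> is near \<open>(g n, m)\<close>, which is near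
  \<open>(h, m)\<close> once \<open>g n\<close> is near \<open>h\<close>. Hence powers of
  \<open>(\<one>, 1)\<close> come arbitrarily close to every point.\<close>

lemma monothetic_word_topology:
  assumes T: "topological_group G T"
    and dense: "\<forall>U. openin T U \<and> U \<noteq> {} \<longrightarrow> (\<forall>m. \<exists>n\<ge>m. g n \<in> U)"
  shows "monothetic_group (G \<times>\<times> integer_group) (word_topology T)"
proof -
  interpret P: group_nhds_base "G \<times>\<times> integer_group" "word_nhds T"
    by (rule group_nhds_base_word_nhds[OF T])
  have pow: "(\<one>, 1) [^]\<^bsub>G \<times>\<times> integer_group\<^esub> (k :: nat) = (\<one>, int k)" for k
    by (induction k) auto
  have pow_int: "(\<one>, 1) [^]\<^bsub>G \<times>\<times> integer_group\<^esub> (k :: int) = (\<one>, k)" for k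
    by (cases "k \<ge> 0") (auto simp: int_pow_def2 pow is_group)
  have gen: "generate (G \<times>\<times> integer_group) {(\<one>, 1)} = {\<one>} \<times> UNIV"
    by (subst P.generate_pow) (auto simp: pow_int)
  have "(h, m) \<in> word_topology T closure_of ({\<one>} \<times> UNIV)" if h: "h \<in> carrier G" for h m
    unfolding in_closure_of
  proof (intro conjI allI impI)
    show "(h, m) \<in> topspace (word_topology T)"
      using h by (simp add: P.topspace_base_topology)
    fix A assume A: "(h, m) \<in> A \<and> openin (word_topology T) A"
    obtain U r where U: "openin T U" "\<one> \<in> U" "r > 0"
      and sub: "\<And>b. b \<in> word_nhd U r \<Longrightarrow> (h, m) \<otimes>\<^bsub>G \<times>\<times> integer_group\<^esub> b \<in> A"
      by (rule openin_word_topologyE[OF T A[THEN conjunct2] A[THEN conjunct1]]) blast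
    obtain k where k: "inverse (real (Suc k)) < r" using reals_Archimedean[OF U(3)] by blast
    have "h \<in> {x \<in> carrier G. inv h \<otimes> x \<in> U}" using h U by simp
    \<comment> \<open>Recurrence of \<open>g\<close> yields closeness to \<open>h\<close> and an
      index beyond \<open>k\<close> at once.\<close>
    then obtain n where n: "n \<ge> k" "inv h \<otimes> g n \<in> U"
      using dense topological_group_openin_translation[OF T inv_closed[OF h] U(1)] by blast
    have "1 / (real n + 1) \<le> inverse (real (Suc k))"
      using n(1) by (simp add: field_simps)
    \<comment> \<open>The inverse of \<open>(g n, - fact n)\<close>: its group part cancels
      \<open>g n\<close> in \<open>inv h \<otimes> g n\<close>, leaving
      \<open>(inv h, fact n)\<close>, which multiplies \<open>(h, m)\<close> into
      \<open>{\<one>} \<times> UNIV\<close>.\<close>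
    then have "(inv (g n), - (- fact n)) \<in> small_words r"
      using k by (intro small_words_inv small_words_generator) simp
    then have "((inv h \<otimes> g n) \<otimes> inv (g n), fact n) \<in> word_nhd U r"
      using word_nhdI[OF n(2)] by simp
    then have "(inv h, fact n) \<in> word_nhd U r" using h by (simp add: m_assoc)
    then have "(\<one>, m + fact n) \<in> A" using sub h by fastforce
    then show "\<exists>y. y \<in> {\<one>} \<times> UNIV \<and> y \<in> A" by blast
  qed
  then have "topspace (word_topology T) \<subseteq> word_topology T closure_of ({\<one>} \<times> UNIV)"
    by (auto simp: P.topspace_base_topology)
  then have "word_topology T closure_of ({\<one>} \<times> UNIV) = topspace (word_topology T)"
    by (simp add: closure_of_subset_topspace subset_antisym)
  then show ?thesis
    unfolding monothetic_group_def using gen P.topological_group_base_topology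
    by (intro conjI bexI[of _ "(\<one>, 1)"]) auto
qed

text \<open>The embedding is continuous because each neighbourhood contains
  \<open>U \<times> {0}\<close>; its inverse is continuous because at radius 1 the neighbourhood
  meets \<open>G \<times> {0}\<close> in nothing more.\<close>

lemma homeomorphic_map_word_topology:
  assumes T: "topological_group G T"
  shows "homeomorphic_map T (subtopology (word_topology T) (carrier G \<times> {0})) (\<lambda>x. (x, 0))"
proof -
  interpret P: group_nhds_base "G \<times>\<times> integer_group" "word_nhds T"
    by (rule group_nhds_base_word_nhds[OF T])
  let ?S = "subtopology (word_topology T) (carrier G \<times> {0})"
  have top: "topspace T = carrier G" using T by (simp add: topological_group_def)
  have topS: "topspace ?S = carrier G \<times> {0}"
    by (auto simp: P.topspace_base_topology)
  have "continuous_map T ?S (\<lambda>x. (x, 0))"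
    unfolding continuous_map_in_subtopology
  proof (intro conjI)
    show "(\<lambda>x. (x, 0)) \<in> topspace T \<rightarrow> carrier G \<times> {0}" by (auto simp: top)
    show "continuous_map T (word_topology T) (\<lambda>x. (x, 0))"
      unfolding continuous_map_def
    proof (intro conjI allI impI)
      show "(\<lambda>x. (x, 0)) \<in> topspace T \<rightarrow> topspace (word_topology T)"
        by (auto simp: top P.topspace_base_topology)
      fix A assume A: "openin (word_topology T) A"
      show "openin T {x \<in> topspace T. (x, 0) \<in> A}"
      proof (subst openin_subopen, intro ballI)
        fix x assume "x \<in> {x \<in> topspace T. (x, 0) \<in> A}"
        then have x: "x \<in> carrier G" "(x, 0) \<in> A" by (auto simp: top)
        obtain U r where U: "openin T U" "\<one> \<in> U" "r > 0"
          and sub: "\<And>b. b \<in> word_nhd U r \<Longrightarrow> (x, 0) \<otimes>\<^bsub>G \<times>\<times> integer_group\<^esub> b \<in> A"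
          by (rule openin_word_topologyE[OF T A x(2)]) blast
        let ?V = "{y \<in> carrier G. inv x \<otimes> y \<in> U}"
        have "(y, 0) \<in> A" if "y \<in> ?V" for y
        proof -
          \<comment> \<open>The trailing \<open>\<one>\<close> is the empty word, which has length
            0.\<close>
          have "(inv x \<otimes> y \<otimes> \<one>, 0) \<in> word_nhd U r"
            using that small_words_one[OF U(3)] by (intro word_nhdI) auto
          then have "(x, 0) \<otimes>\<^bsub>G \<times>\<times> integer_group\<^esub> (inv x \<otimes> y \<otimes> \<one>, 0) \<in> A"
            using sub by blast
          then show ?thesis using x that by (simp flip: m_assoc)
        qed
        then show "\<exists>V. openin T V \<and> x \<in> V \<and> V \<subseteq> {x \<in> topspace T. (x, 0) \<in> A}"
          using topological_group_openin_translation[OF T inv_closed[OF x(1)] U(1)] x U(2)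
          by (intro exI[of _ ?V]) (auto simp: top)
      qed
    qed
  qed
  moreover have "continuous_map ?S T fst"
    unfolding continuous_map_def
  proof (intro conjI allI impI)
    show "fst \<in> topspace ?S \<rightarrow> topspace T" unfolding topS top by auto
    fix V assume V: "openin T V"
    show "openin ?S {p \<in> topspace ?S. fst p \<in> V}"
    proof (subst openin_subopen, intro ballI)
      fix p assume "p \<in> {p \<in> topspace ?S. fst p \<in> V}"
      then obtain x where p: "p = (x, 0)" and x: "x \<in> carrier G" "x \<in> V" unfolding topS by auto
      let ?U = "{y \<in> carrier G. x \<otimes> y \<in> V}"
      \<comment> \<open>1 is the largest radius that \<open>word_nhd_kernel\<close> admits.\<close>
      have U: "word_nhd ?U 1 \<in> word_nhds T"
        using topological_group_openin_translation[OF T x(1) V] x by (intro word_nhdsI) auto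
      \<comment> \<open>The neighbourhood is not known to be open, so an open set inside its
        translate is used.\<close>
      obtain A where A: "openin (word_topology T) A" "p \<in> A"
        "\<And>q. q \<in> A \<Longrightarrow> \<exists>b\<in>word_nhd ?U 1. q = (x, 0) \<otimes>\<^bsub>G \<times>\<times> integer_group\<^esub> b"
        using P.base_topology_nhd[OF _ U, of p] x unfolding p by auto
      have "fst q \<in> V" if q: "q \<in> A" "q \<in> carrier G \<times> {0}" for q
      proof -
        obtain b k where b: "(b, k) \<in> word_nhd ?U 1" "q = (x \<otimes> b, k)"
          using A(3)[OF q(1)] by fastforce
        \<comment> \<open>Membership of \<open>q\<close> in the slice means \<open>k = 0\<close>, so
          the word contributes nothing.\<close>
        then have "b \<in> ?U" using word_nhd_kernel[of b ?U 1] q(2) by auto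
        then show ?thesis using b by simp
      qed
      then have "A \<inter> (carrier G \<times> {0}) \<subseteq> {p \<in> topspace ?S. fst p \<in> V}"
        unfolding topS by blast
      moreover have "openin ?S (A \<inter> (carrier G \<times> {0}))"
        using A(1) by (simp add: openin_subtopology_Int)
      ultimately show "\<exists>W. openin ?S W \<and> p \<in> W \<and> W \<subseteq> {p \<in> topspace ?S. fst p \<in> V}"
        using A(2) x p by (intro exI[of _ "A \<inter> (carrier G \<times> {0})"]) auto
    qed
  qed
  ultimately have "homeomorphic_maps T ?S (\<lambda>x. (x, 0)) fst"
    unfolding homeomorphic_maps_def topS by auto
  then show ?thesis using homeomorphic_map_maps by blast
qed

end

theorem theorem1p1:
  fixes G :: "('a, 'm) monoid_scheme" and T :: "'a topology"
  assumes "topological_group G T"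
    and "comm_group G"
    and "separable_space T"
  shows "\<exists>(M :: ('a \<times> int) monoid) (S :: ('a \<times> int) topology) H.
           monothetic_group M S \<and> subgroup H M \<and>
           topological_group_isomorphic G T (M\<lparr>carrier := H\<rparr>) (subtopology S H)"
proof -
  interpret comm_group G by (rule assms(2))
  have top: "topspace T = carrier G" using assms(1) by (simp add: topological_group_def)
  then have nonempty: "topspace T \<noteq> {}" using one_closed by blast
  obtain g :: "nat \<Rightarrow> 'a" where g: "range g \<subseteq> topspace T"
    and dense: "\<forall>U. openin T U \<and> U \<noteq> {} \<longrightarrow> (\<forall>m. \<exists>n\<ge>m. g n \<in> U)"
    by (rule dense_sequence_frequently[OF assms(3) nonempty])
  interpret sequence_in_comm_group G g by unfold_locales (use g top in auto)
  let ?M = "G \<times>\<times> integer_group" and ?H = "carrier G \<times> {0 :: int}"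
  have "subgroup {0} integer_group"
    using group.triv_subgroup[OF group_integer_group] by simp
  then have "subgroup ?H ?M"
    by (intro DirProd_subgroups is_group group_integer_group subgroup_self)
  \<comment> \<open>The same map is the homeomorphism of
    \<open>homeomorphic_map_word_topology\<close>, so one witness serves both the algebra and the
    topology.\<close>
  moreover have "(\<lambda>x. (x, 0)) \<in> iso G (?M\<lparr>carrier := ?H\<rparr>)"
    by (auto simp: iso_def hom_def bij_betw_def inj_on_def)
  ultimately show ?thesis
    unfolding topological_group_isomorphic_def
    using monothetic_word_topology[OF assms(1) dense] homeomorphic_map_word_topology[OF assms(1)]
    by blast
qed

end
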